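(* Let $n\ge 1$, let $\mathsf{M}$ be a matroid on $[n]$, and let $f=\{f_\sigma:\sigma\in S_n\}\in\mathrm{PLaur}(\Sigma_n)$ be a piecewise Laurent polynomial on the braid fan $\Sigma_n$. Then the rational function $$Q_{\mathsf{M}}(f)=\sum_{\sigma\in S_n} f_\sigma\, Q(C_\sigma)\prod_{i\in[n]\setminus B_{\mathsf{M}}(\sigma)}(1-x_i)\in\mathbb{Z}(x_1,\dots,x_n)$$ is a Laurent polynomial, i.e. $Q_{\mathsf{M}}(f)\in\mathbb{Z}[x_1^{\pm1},\dots,x_n^{\pm1}]$.
   Context: $[n]=\{1,\dots,n\}$; $S_n$ is the set of permutations $\sigma:[n]\to[n]$; $\tau_i\in S_n$ is the adjacent transposition swapping $i$ and $i+1$. A piecewise Laurent polynomial on the braid fan $\Sigma_n$ is a collection $f=\{f_\sigma:\sigma\in S_n\}$ of Laurent polynomials $f_\sigma\in\mathbb{Z}[x_1^{\pm1},\dots,x_n^{\pm1}]$ such that for every $\sigma\in S_n$ and $i\in[n-1]$, $f_\sigma-f_{\sigma\circ\tau_i}$ is divisible in $\mathbb{Z}[x_1^{\pm1},\dots,x_n^{\pm1}]$ by $x_{\sigma(i)}-x_{\sigma(i+1)}$. The ring of these (componentwise operations) is $\mathrm{PLaur}(\Sigma_n)$. For a matroid $\mathsf{M}$ on $[n]$ with rank function $\mathrm{rk}_{\mathsf{M}}$, the greedy basis determined by $\sigma\in S_n$ is the basis $$B_{\mathsf{M}}(\sigma)=\{\sigma(i): \mathrm{rk}_{\mathsf{M}}\{\sigma(1),\dots,\sigma(i)\}>\mathrm{rk}_{\mathsf{M}}\{\sigma(1),\dots,\sigma(i-1)\}\}.$$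 For $\sigma\in S_n$, $$Q(C_\sigma)=\frac{1}{\prod_{i=1}^{n-1}\left(1-\frac{x_{\sigma(i+1)}}{x_{\sigma(i)}}\right)}.$$ *)

theory Defs
  imports
    "HOL-Library.Poly_Mapping"
    "HOL-Computational_Algebra.Polynomial_Factorial"
    "HOL-Combinatorics.Permutations"
begin

text \<open>
  Laurent polynomials over the integers are the elements of the group ring of the free abelian
  group of exponent vectors \<open>nat \<Rightarrow>\<^sub>0 int\<close>; multiplication is the convolution product of
  \<open>Poly_Mapping\<close>.  The type has a variable for every natural number, and the ring in the
  variables with indices 1 to n is cut out by \<open>laurent_ring n\<close>.
\<close>

type_synonym laurent = "(nat \<Rightarrow>\<^sub>0 int) \<Rightarrow>\<^sub>0 int"

definition laurent_var :: "nat \<Rightarrow> laurent" where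
  "laurent_var i = Poly_Mapping.single (Poly_Mapping.single i 1) 1"

definition laurent_ring :: "nat \<Rightarrow> laurent set" where
  "laurent_ring n = {p. \<forall>m \<in> Poly_Mapping.keys p. Poly_Mapping.keys m \<subseteq> {1..n}}"

text \<open>
  The field of fractions of all Laurent polynomials contains the field of rational functions in
  the variables 1 to n; \<open>to_fract\<close> is the embedding of Laurent polynomials.
\<close>

definition ratfun_var :: "nat \<Rightarrow> laurent fract" where
  "ratfun_var i = to_fract (laurent_var i)"

text \<open>
  Only the values of f on permutations of \<open>{1..n}\<close> are constrained.  The divisibility is in
  \<open>laurent_ring n\<close>, hence the explicit cofactor.
\<close>

definition PLaur :: "nat \<Rightarrow> ((nat \<Rightarrow> nat) \<Rightarrow> laurent) set" where
  "PLaur n = {f.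
     (\<forall>\<sigma>. \<sigma> permutes {1..n} \<longrightarrow> f \<sigma> \<in> laurent_ring n) \<and>
     (\<forall>\<sigma>. \<sigma> permutes {1..n} \<longrightarrow> (\<forall>i \<in> {1..<n}. \<exists>g \<in> laurent_ring n.
        f \<sigma> - f (\<sigma> \<circ> transpose i (i + 1))
          = (laurent_var (\<sigma> i) - laurent_var (\<sigma> (i + 1))) * g))}"

locale matroid =
  fixes E :: "'a set" and indep :: "'a set \<Rightarrow> bool"
  assumes finite_ground: "finite E"
    and indep_subset_ground: "indep I \<Longrightarrow> I \<subseteq> E"
    and indep_empty: "indep {}"
    and indep_subset: "indep J \<Longrightarrow> I \<subseteq> J \<Longrightarrow> indep I"
    and augment: "indep I \<Longrightarrow> indep J \<Longrightarrow> card I < card J \<Longrightarrow> \<exists>e \<in> J - I. indep (insert e I)"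

definition matroid_rank :: "('a set \<Rightarrow> bool) \<Rightarrow> 'a set \<Rightarrow> nat" where
  "matroid_rank indep S = Max (card ` {I. I \<subseteq> S \<and> indep I})"

definition greedy_basis :: "nat \<Rightarrow> (nat set \<Rightarrow> bool) \<Rightarrow> (nat \<Rightarrow> nat) \<Rightarrow> nat set" where
  "greedy_basis n indep \<sigma> =
     {\<sigma> i | i. i \<in> {1..n} \<and>
        matroid_rank indep (\<sigma> ` {1..i}) > matroid_rank indep (\<sigma> ` {1..i - 1})}"

definition Q_cone :: "nat \<Rightarrow> (nat \<Rightarrow> nat) \<Rightarrow> laurent fract" where
  "Q_cone n \<sigma> = 1 / (\<Prod>i \<in> {1..<n}. 1 - ratfun_var (\<sigma> (i + 1)) / ratfun_var (\<sigma> i))"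

definition Q_matroid ::
  "nat \<Rightarrow> (nat set \<Rightarrow> bool) \<Rightarrow> ((nat \<Rightarrow> nat) \<Rightarrow> laurent) \<Rightarrow> laurent fract" where
  "Q_matroid n indep f =
     (\<Sum>\<sigma> | \<sigma> permutes {1..n}.
        to_fract (f \<sigma>) * Q_cone n \<sigma> *
        (\<Prod>i \<in> {1..n} - greedy_basis n indep \<sigma>. 1 - ratfun_var i))"

end

theory Submission
  imports Defs
begin

text \<open>
  The only possible poles of the sum are the divisors \<open>x\<^sub>a = x\<^sub>b\<close>, so it suffices to show regularity
  along each of them.  The summands of \<open>\<sigma>\<close> and \<open>(a b) \<circ> \<sigma>\<close> are regular there unless \<open>a\<close> and \<open>b\<close> are
  adjacent values of \<open>\<sigma>\<close>.  In that case each has a simple pole, and the residues cancel: \<open>f\<close> takes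
  congruent values modulo \<open>x\<^sub>a - x\<^sub>b\<close>, the two pole factors have opposite signs, and the greedy bases
  are equal or exchanged by the transposition \<open>(a b)\<close>, because swapping two neighbours changes a
  single set of the flag and the rank grows by at most one in each step.
\<close>

section \<open>Monomial substitutions\<close>

text \<open>Exponent vectors and Laurent polynomials both form free abelian groups. Applying
  \<open>frag_extend\<close> twice therefore gives the ring endomorphism that sends the variable
  with index \<open>i\<close> to the monomial with exponent vector \<open>e i\<close>. Monomials are
  units, so negative exponents cause no trouble.\<close>

definition monomial_subst :: "(nat \<Rightarrow> (nat \<Rightarrow>\<^sub>0 int)) \<Rightarrow> laurent \<Rightarrow> laurent" where
  "monomial_subst e = frag_extend (\<lambda>m. frag_of (frag_extend e m))"

lemma monomial_subst_of [simp]: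
  "monomial_subst e (frag_of m) = frag_of (frag_extend e m)"
  by (simp add: monomial_subst_def)

lemma monomial_subst_0 [simp]: "monomial_subst e 0 = 0"
  by (simp add: monomial_subst_def)

lemma monomial_subst_1 [simp]: "monomial_subst e 1 = 1"
  using monomial_subst_of[of e 0] by simp

lemma monomial_subst_diff: "monomial_subst e (p - q) = monomial_subst e p - monomial_subst e q"
  by (simp add: monomial_subst_def frag_extend_diff)

lemma monomial_subst_add: "monomial_subst e (p + q) = monomial_subst e p + monomial_subst e q"
  by (simp add: monomial_subst_def frag_extend_add)

text \<open>Bilinearity reduces the claim to monomials, where multiplication adds exponent vectors
  and \<open>frag_extend e\<close> is additive.\<close>

lemma monomial_subst_mult: "monomial_subst e (p * q) = monomial_subst e p * monomial_subst e q"
proof -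
  have of_mult: "monomial_subst e (frag_of m * q) = monomial_subst e (frag_of m) * monomial_subst e q" for m
    using subset_UNIV[of "Poly_Mapping.keys q"]
  proof (induction q rule: frag_induction)
    case (one k)
    show ?case by (simp add: mult_single frag_extend_add)
  next
    case (diff p q)
    then show ?case by (simp only: right_diff_distrib monomial_subst_diff)
  qed simp
  show ?thesis
    using subset_UNIV[of "Poly_Mapping.keys p"]
  proof (induction p rule: frag_induction)
    case (one m)
    show ?case by (rule of_mult)
  next
    case (diff a b)
    then show ?case by (simp only: left_diff_distrib monomial_subst_diff)
  qed simp
qed

lemma laurent_var_neq: "a \<noteq> b \<Longrightarrow> laurent_var a \<noteq> laurent_var b"
  unfolding laurent_var_def by (metis keys_frag_of singleton_inject)

lemma laurent_var_nonzero [simp]: "laurent_var a \<noteq> 0"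
  unfolding laurent_var_def by simp

text \<open>Restriction to the divisor x_a = x_b, realised as an endomorphism of the same
  ring.\<close>

abbreviation identify :: "nat \<Rightarrow> nat \<Rightarrow> laurent \<Rightarrow> laurent" where
  "identify a b \<equiv> monomial_subst (\<lambda>i. frag_of (if i = a then b else i))"

lemma identify_var: "identify a b (laurent_var i) = laurent_var (if i = a then b else i)"
  by (simp add: laurent_var_def)

text \<open>Induction over exponent vectors settles monomials, and induction over linear
  combinations does the rest. In consequence, anything killed by \<open>identify a b\<close> is a
  multiple of x_a - x_b.\<close>

lemma var_diff_dvd_identify: "laurent_var a - laurent_var b dvd p - identify a b p"
proof -
  define h :: "(nat \<Rightarrow>\<^sub>0 int) \<Rightarrow> (nat \<Rightarrow>\<^sub>0 int)" where
    "h = frag_extend (\<lambda>i. frag_of (if i = a then b else i))"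
  let ?d = "laurent_var a - laurent_var b"
  have mono: "?d dvd frag_of m - frag_of (h m)" for m
    using subset_UNIV[of "Poly_Mapping.keys m"]
  proof (induction m rule: frag_induction)
    case zero
    show ?case by (simp add: h_def)
  next
    case (one i)
    show ?case by (simp add: h_def laurent_var_def)
  next
    case (diff k l)
    \<comment> \<open>Telescoping through the monomial with exponent \<open>h k - l\<close>. The
      coefficients in front are again monomials, so negative exponents are covered by the same
      induction.\<close>
    have "frag_of (k - l) - frag_of (h (k - l)) =
        frag_of (- l) * (frag_of k - frag_of (h k))
        - frag_of (h k - l - h l) * (frag_of l - frag_of (h l))"
      by (simp add: right_diff_distrib mult_single h_def frag_extend_diff algebra_simps)
    with diff show ?case
      by (simp add: dvd_diff dvd_mult)
  qed
  show ?thesis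
    using subset_UNIV[of "Poly_Mapping.keys p"]
  proof (induction p rule: frag_induction)
    case (one m)
    show ?case using mono[of m] by (simp add: h_def)
  next
    case (diff p q)
    have "p - q - identify a b (p - q) = (p - identify a b p) - (q - identify a b q)"
      by (simp add: monomial_subst_diff)
    with dvd_diff[OF diff] show ?case by (simp only:)
  qed simp
qed

section \<open>Laurent polynomials in finitely many variables\<close>

text \<open>Variables with index outside \<open>{1..n}\<close> are set to 1, the monomial with
  exponent vector 0.\<close>

abbreviation truncate_vars :: "nat \<Rightarrow> laurent \<Rightarrow> laurent" where
  "truncate_vars n \<equiv> monomial_subst (\<lambda>i. if i \<in> {1..n} then frag_of i else 0)"

text \<open>As the fixed points of a ring endomorphism, the subring inherits its closure properties
  at once. The same description later allows an equation to be restricted to the first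
  \<open>n\<close> variables.\<close>

lemma laurent_ring_iff: "p \<in> laurent_ring n \<longleftrightarrow> truncate_vars n p = p"
proof
  let ?e = "\<lambda>i. if i \<in> {1..n} then frag_of i else (0 :: nat \<Rightarrow>\<^sub>0 int)"
  assume p: "p \<in> laurent_ring n"
  have "frag_of (frag_extend ?e m) = frag_of m" if "m \<in> Poly_Mapping.keys p" for m
  proof -
    have "Poly_Mapping.keys m \<subseteq> {1..n}" using p that by (auto simp: laurent_ring_def)
    then have "frag_extend ?e m = frag_extend frag_of m"
      by (intro frag_extend_eq) auto
    then show ?thesis by (simp flip: frag_expansion)
  qed
  then have "truncate_vars n p = frag_extend frag_of p"
    unfolding monomial_subst_def by (intro frag_extend_eq)
  then show "truncate_vars n p = p" by (simp flip: frag_expansion)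
next
  let ?e = "\<lambda>i. if i \<in> {1..n} then frag_of i else (0 :: nat \<Rightarrow>\<^sub>0 int)"
  assume p: "truncate_vars n p = p"
  show "p \<in> laurent_ring n"
    unfolding laurent_ring_def
  proof (intro CollectI ballI)
    fix m assume "m \<in> Poly_Mapping.keys p"
    then have "m \<in> Poly_Mapping.keys (truncate_vars n p)" by (simp only: p)
    then obtain k where "m = frag_extend ?e k"
      unfolding monomial_subst_def using keys_frag_extend by fastforce
    then have "Poly_Mapping.keys m \<subseteq> (\<Union>i\<in>Poly_Mapping.keys k. Poly_Mapping.keys (?e i))"
      by (simp only: keys_frag_extend)
    then show "Poly_Mapping.keys m \<subseteq> {1..n}" by (auto split: if_splits)
  qed
qed

abbreviation laurent_fracts :: "nat \<Rightarrow> laurent fract set" where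
  "laurent_fracts n \<equiv> to_fract ` laurent_ring n"

lemma laurent_fracts_1: "1 \<in> laurent_fracts n"
  by (rule image_eqI[of _ _ 1]) (simp_all add: laurent_ring_iff)

lemma laurent_fracts_0: "0 \<in> laurent_fracts n"
  by (rule image_eqI[of _ _ 0]) (simp_all add: laurent_ring_iff)

lemma laurent_fracts_var: "i \<in> {1..n} \<Longrightarrow> ratfun_var i \<in> laurent_fracts n"
  by (auto simp: laurent_ring_iff ratfun_var_def laurent_var_def)

lemma laurent_fracts_add:
  assumes "u \<in> laurent_fracts n" "v \<in> laurent_fracts n"
  shows "u + v \<in> laurent_fracts n"
proof -
  obtain p q where "u = to_fract p" "v = to_fract q" "p \<in> laurent_ring n" "q \<in> laurent_ring n"
    using assms by auto
  then show ?thesis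
    by (intro image_eqI[of _ _ "p + q"]) (simp_all add: laurent_ring_iff monomial_subst_add)
qed

lemma laurent_fracts_diff:
  assumes "u \<in> laurent_fracts n" "v \<in> laurent_fracts n"
  shows "u - v \<in> laurent_fracts n"
proof -
  obtain p q where "u = to_fract p" "v = to_fract q" "p \<in> laurent_ring n" "q \<in> laurent_ring n"
    using assms by auto
  then show ?thesis
    by (intro image_eqI[of _ _ "p - q"]) (simp_all add: laurent_ring_iff monomial_subst_diff)
qed

lemma laurent_fracts_mult:
  assumes "u \<in> laurent_fracts n" "v \<in> laurent_fracts n"
  shows "u * v \<in> laurent_fracts n"
proof -
  obtain p q where "u = to_fract p" "v = to_fract q" "p \<in> laurent_ring n" "q \<in> laurent_ring n"
    using assms by auto
  then show ?thesis
    by (intro image_eqI[of _ _ "p * q"]) (simp_all add: laurent_ring_iff monomial_subst_mult)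
qed

lemma laurent_fracts_sum:
  "(\<And>i. i \<in> A \<Longrightarrow> u i \<in> laurent_fracts n) \<Longrightarrow> sum u A \<in> laurent_fracts n"
  by (induction A rule: infinite_finite_induct) (auto simp: laurent_fracts_0 intro!: laurent_fracts_add)

lemma laurent_fracts_prod:
  "(\<And>i. i \<in> A \<Longrightarrow> u i \<in> laurent_fracts n) \<Longrightarrow> prod u A \<in> laurent_fracts n"
  by (induction A rule: infinite_finite_induct) (auto simp: laurent_fracts_1 intro!: laurent_fracts_mult)

lemma ratfun_var_eq_iff [simp]: "ratfun_var a = ratfun_var b \<longleftrightarrow> a = b"
  unfolding ratfun_var_def using laurent_var_neq by auto

lemma ratfun_var_nonzero [simp]: "ratfun_var a \<noteq> 0"
  by (simp add: ratfun_var_def)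

section \<open>Regularity along the divisor where two variables coincide\<close>

text \<open>For distinct \<open>a\<close> and \<open>b\<close> this is the localisation at the prime
  ideal generated by x_a - x_b: denominators must not vanish on the divisor. For
  \<open>a = b\<close> it is the whole fraction field.\<close>

definition regular_at :: "nat \<Rightarrow> nat \<Rightarrow> laurent fract set" where
  "regular_at a b = {to_fract p / to_fract q | p q. identify a b q \<noteq> 0}"

lemma regular_atE:
  assumes "u \<in> regular_at a b"
  obtains p q where "u = to_fract p / to_fract q" "identify a b q \<noteq> 0" "q \<noteq> 0"
  using assms unfolding regular_at_def by force

lemma regular_at_to_fract [simp, intro]: "to_fract p \<in> regular_at a b"
  unfolding regular_at_def by (intro CollectI exI[of _ p] exI[of _ 1]) simp

lemma regular_at_0 [simp]: "0 \<in> regular_at a b"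
  using regular_at_to_fract[of 0] by simp

lemma regular_at_1 [simp]: "1 \<in> regular_at a b"
  using regular_at_to_fract[of 1] by simp

lemma regular_at_var [simp]: "ratfun_var i \<in> regular_at a b"
  by (auto simp: ratfun_var_def)

lemma regular_at_mult:
  assumes "u \<in> regular_at a b" "v \<in> regular_at a b"
  shows "u * v \<in> regular_at a b"
proof -
  obtain p q where "u = to_fract p / to_fract q" "identify a b q \<noteq> 0"
    using assms(1) by (rule regular_atE)
  moreover obtain p' q' where "v = to_fract p' / to_fract q'" "identify a b q' \<noteq> 0"
    using assms(2) by (rule regular_atE)
  ultimately show ?thesis
    unfolding regular_at_def
    by (intro CollectI exI[of _ "p * p'"] exI[of _ "q * q'"]) (simp add: monomial_subst_mult)
qed

lemma regular_at_add:
  assumes "u \<in> regular_at a b" "v \<in> regular_at a b"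
  shows "u + v \<in> regular_at a b"
proof -
  obtain p q where "u = to_fract p / to_fract q" "identify a b q \<noteq> 0" "q \<noteq> 0"
    using assms(1) by (rule regular_atE)
  moreover obtain p' q' where "v = to_fract p' / to_fract q'" "identify a b q' \<noteq> 0" "q' \<noteq> 0"
    using assms(2) by (rule regular_atE)
  ultimately show ?thesis
    unfolding regular_at_def
    by (intro CollectI exI[of _ "p * q' + p' * q"] exI[of _ "q * q'"])
      (simp add: monomial_subst_mult add_frac_eq)
qed

lemma regular_at_uminus: "u \<in> regular_at a b \<Longrightarrow> - u \<in> regular_at a b"
  using regular_at_mult[OF regular_at_to_fract[of "-1"], of u] by simp

lemma regular_at_diff:
  "u \<in> regular_at a b \<Longrightarrow> v \<in> regular_at a b \<Longrightarrow> u - v \<in> regular_at a b"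
  using regular_at_add[of u a b "- v"] regular_at_uminus[of v] by simp

lemma regular_at_prod:
  "(\<And>i. i \<in> A \<Longrightarrow> u i \<in> regular_at a b) \<Longrightarrow> prod u A \<in> regular_at a b"
  by (induction A rule: infinite_finite_induct) (auto intro!: regular_at_mult)

lemma regular_at_sum:
  "(\<And>i. i \<in> A \<Longrightarrow> u i \<in> regular_at a b) \<Longrightarrow> sum u A \<in> regular_at a b"
  by (induction A rule: infinite_finite_induct) (auto intro!: regular_at_add)

text \<open>The constant 2 survives the identification of variables, so it is a unit of the local
  ring although it is not a unit among integral Laurent polynomials.\<close>

lemma regular_at_half:
  assumes "u + u \<in> regular_at a b"
  shows "u \<in> regular_at a b"
proof -
  have two: "(2 :: laurent) \<noteq> 0"
    by simp
  have two': "identify a b 2 = 2"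
    using monomial_subst_add[of _ 1 1] by simp
  have "1 / to_fract (2 :: laurent) \<in> regular_at a b"
    unfolding regular_at_def by (intro CollectI exI[of _ 1] exI[of _ 2]) (simp add: two')
  then have "1 / to_fract (2 :: laurent) * (u + u) \<in> regular_at a b"
    using assms by (intro regular_at_mult)
  also have "u + u = to_fract 2 * u"
    using to_fract_add[of "1 :: laurent" 1] by (simp flip: mult_2)
  also have "1 / to_fract 2 * (to_fract 2 * u) = u"
    using two by (simp del: to_fract_add)
  finally show ?thesis .
qed

text \<open>Two distinct variables become equal under the identification only if they are x_a and
  x_b; otherwise their difference is an admissible denominator.\<close>

lemma regular_at_inverse_var_diff:
  assumes "c \<noteq> d" "{c, d} \<noteq> {a, b}"
  shows "1 / (ratfun_var c - ratfun_var d) \<in> regular_at a b"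
proof -
  have "(if c = a then b else c) \<noteq> (if d = a then b else d)"
    using assms by auto
  then have "identify a b (laurent_var c - laurent_var d) \<noteq> 0"
    by (simp only: monomial_subst_diff identify_var laurent_var_neq right_minus_eq not_False_eq_True)
  then show ?thesis
    unfolding regular_at_def ratfun_var_def
    by (intro CollectI exI[of _ 1] exI[of _ "laurent_var c - laurent_var d"]) simp
qed

text \<open>With \<open>u\<close> = p/q and the product equal to r, clearing denominators gives (x_a
  - x_b) p = r q. Restriction to the divisor kills the left side but not q, so r vanishes there and
  is divisible by x_a - x_b.\<close>

lemma regular_at_cancel_var_diff:
  assumes "a \<noteq> b" "u \<in> regular_at a b" "(ratfun_var a - ratfun_var b) * u \<in> range to_fract"
  shows "u \<in> range to_fract"
proof -
  obtain p q where u: "u = to_fract p / to_fract q" "identify a b q \<noteq> 0" "q \<noteq> 0"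
    using assms(2) by (rule regular_atE)
  obtain r where r: "(ratfun_var a - ratfun_var b) * u = to_fract r"
    using assms(3) by auto
  have "to_fract ((laurent_var a - laurent_var b) * p) = to_fract (r * q)"
    using r u by (simp add: ratfun_var_def field_simps)
  then have "identify a b ((laurent_var a - laurent_var b) * p) = identify a b (r * q)"
    by (simp only: to_fract_eq_iff)
  then have "identify a b r = 0"
    using u by (simp add: monomial_subst_mult monomial_subst_diff identify_var)
  then obtain g where "r = (laurent_var a - laurent_var b) * g"
    using var_diff_dvd_identify[of a b r] by auto
  with r have "(ratfun_var a - ratfun_var b) * u = (ratfun_var a - ratfun_var b) * to_fract g"
    by (simp add: ratfun_var_def)
  then show ?thesis using assms(1) by auto
qed

text \<open>Factors are cancelled one at a time. The product of the remaining ones is a polynomial,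
  hence regular at the current pair, even if an associated factor such as that of
  \<open>(b, a)\<close> is still among them.\<close>

lemma laurent_if_regular:
  assumes "finite A"
    and "\<And>a b. (a, b) \<in> A \<Longrightarrow> a \<noteq> b \<and> u \<in> regular_at a b"
    and "(\<Prod>(a, b)\<in>A. ratfun_var a - ratfun_var b) * u \<in> range to_fract"
  shows "u \<in> range to_fract"
  using assms
proof (induction rule: finite_induct)
  case empty
  then show ?case by simp
next
  case (insert x A)
  obtain a b where x: "x = (a, b)" by (cases x)
  let ?D = "\<Prod>(a, b)\<in>A. ratfun_var a - ratfun_var b"
  have ab: "a \<noteq> b" "u \<in> regular_at a b" using insert.prems(1) x by auto
  have "?D \<in> regular_at a b"
    by (intro regular_at_prod) (auto intro!: regular_at_diff)
  moreover have "(ratfun_var a - ratfun_var b) * (?D * u) \<in> range to_fract"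
    using insert.prems(2) insert.hyps x by (simp add: mult.assoc)
  ultimately have D: "?D * u \<in> range to_fract"
    using regular_at_cancel_var_diff[OF ab(1)] regular_at_mult[OF _ ab(2)] by blast
  show ?case
  proof (rule insert.IH[OF _ D])
    show "c \<noteq> d \<and> u \<in> regular_at c d" if "(c, d) \<in> A" for c d
      using that by (intro insert.prems(1) insertI2)
  qed
qed

section \<open>Congruence modulo a difference of two variables\<close>

definition cong_at :: "nat \<Rightarrow> nat \<Rightarrow> laurent fract \<Rightarrow> laurent fract \<Rightarrow> bool" where
  "cong_at a b u v \<longleftrightarrow> u \<in> regular_at a b \<and> v \<in> regular_at a b \<and>
     (\<exists>w \<in> regular_at a b. u - v = (ratfun_var a - ratfun_var b) * w)"

lemma cong_at_refl: "u \<in> regular_at a b \<Longrightarrow> cong_at a b u u"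
  by (auto simp: cong_at_def intro!: bexI[of _ 0])

lemma cong_at_sym: "cong_at a b u v \<Longrightarrow> cong_at a b v u"
  unfolding cong_at_def by (metis minus_diff_eq mult_minus_right regular_at_uminus)

lemma cong_at_diff:
  assumes "cong_at a b u v" "cong_at a b u' v'"
  shows "cong_at a b (u - u') (v - v')"
proof -
  obtain w w' where w: "w \<in> regular_at a b" "u - v = (ratfun_var a - ratfun_var b) * w"
     "w' \<in> regular_at a b" "u' - v' = (ratfun_var a - ratfun_var b) * w'"
    using assms unfolding cong_at_def by blast
  have "(u - u') - (v - v') = (u - v) - (u' - v')"
    by simp
  also have "\<dots> = (ratfun_var a - ratfun_var b) * (w - w')"
    using w by (simp only: right_diff_distrib)
  finally show ?thesis
    using assms w by (auto simp: cong_at_def intro!: regular_at_diff)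
qed

text \<open>The difference splits as (u - v) u' + v (u' - v'). Its cofactor is regular because u'
  and v are, which is why \<open>cong_at\<close> records the regularity of both sides.\<close>

lemma cong_at_mult:
  assumes "cong_at a b u v" "cong_at a b u' v'"
  shows "cong_at a b (u * u') (v * v')"
proof -
  obtain w w' where w: "w \<in> regular_at a b" "u - v = (ratfun_var a - ratfun_var b) * w"
     "w' \<in> regular_at a b" "u' - v' = (ratfun_var a - ratfun_var b) * w'"
    using assms unfolding cong_at_def by blast
  have "u * u' - v * v' = (u - v) * u' + v * (u' - v')"
    by (simp add: algebra_simps)
  also have "\<dots> = (ratfun_var a - ratfun_var b) * (w * u' + v * w')"
    unfolding w(2,4) by (simp only: distrib_left mult.assoc mult.left_commute)
  finally show ?thesis
    using assms w unfolding cong_at_def by (metis regular_at_add regular_at_mult)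
qed

lemma cong_at_prod:
  "(\<And>i. i \<in> A \<Longrightarrow> cong_at a b (u i) (v i)) \<Longrightarrow> cong_at a b (prod u A) (prod v A)"
  by (induction A rule: infinite_finite_induct) (auto intro!: cong_at_mult cong_at_refl)

text \<open>This is 1/u - 1/v = -(u - v) / (u v). Regularity of the inverses is a separate premise,
  since a regular element may vanish on the divisor.\<close>

lemma cong_at_inverse:
  assumes "cong_at a b u v" "u \<noteq> 0" "v \<noteq> 0" "1 / u \<in> regular_at a b" "1 / v \<in> regular_at a b"
  shows "cong_at a b (1 / u) (1 / v)"
proof -
  obtain w where w: "w \<in> regular_at a b" "u - v = (ratfun_var a - ratfun_var b) * w"
    using assms unfolding cong_at_def by blast
  have "1 / u - 1 / v = - (u - v) * (1 / u * (1 / v))"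
    using assms(2,3) by (simp add: field_simps)
  also have "\<dots> = (ratfun_var a - ratfun_var b) * (- w * (1 / u * (1 / v)))"
    unfolding w(2) by (simp only: mult_minus_left mult_minus_right mult.assoc)
  finally show ?thesis
    using assms w unfolding cong_at_def
    by (metis regular_at_mult regular_at_uminus)
qed

lemma cong_at_var_transpose: "cong_at a b (ratfun_var i) (ratfun_var (transpose a b i))"
proof -
  have ab: "cong_at a b (ratfun_var a) (ratfun_var b)"
    by (auto simp: cong_at_def intro!: bexI[of _ 1])
  then show ?thesis
    using cong_at_sym[OF ab] by (auto simp: transpose_def intro!: cong_at_refl)
qed

text \<open>The form in which cancellation of residues is used: congruent numerators remove a simple
  pole.\<close>

lemma cong_at_diff_quotient_regular:
  assumes "cong_at a b u v" "a \<noteq> b"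
  shows "(u - v) / (ratfun_var a - ratfun_var b) \<in> regular_at a b"
  using assms by (auto simp: cong_at_def)

section \<open>Greedy bases of adjacent permutations\<close>

context matroid
begin

lemma finite_indep_subsets: "finite (card ` {I. I \<subseteq> S \<and> indep I})"
proof -
  have "{I. I \<subseteq> S \<and> indep I} \<subseteq> Pow E" using indep_subset_ground by auto
  then show ?thesis using finite_ground by (meson finite_Pow_iff finite_imageI finite_subset)
qed

lemma matroid_rank_ge: "I \<subseteq> S \<Longrightarrow> indep I \<Longrightarrow> card I \<le> matroid_rank indep S"
  unfolding matroid_rank_def by (intro Max_ge finite_indep_subsets) auto

lemma matroid_rank_witness: "\<exists>I. I \<subseteq> S \<and> indep I \<and> card I = matroid_rank indep S"
proof -
  have "matroid_rank indep S \<in> card ` {I. I \<subseteq> S \<and> indep I}"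
    unfolding matroid_rank_def using indep_empty by (intro Max_in finite_indep_subsets) auto
  then show ?thesis by auto
qed

text \<open>For the upper bound, \<open>x\<close> is removed from a largest independent subset of
  the bigger set.\<close>

lemma matroid_rank_insert:
  "matroid_rank indep S \<le> matroid_rank indep (insert x S)"
  "matroid_rank indep (insert x S) \<le> matroid_rank indep S + 1"
proof -
  show "matroid_rank indep S \<le> matroid_rank indep (insert x S)"
    using matroid_rank_witness[of S] matroid_rank_ge by (metis subset_insertI2)
  obtain I where I: "I \<subseteq> insert x S" "indep I" "card I = matroid_rank indep (insert x S)"
    using matroid_rank_witness by blast
  have "card I \<le> card (I - {x}) + 1"
    using diff_card_le_card_Diff[of "{x}" I] by simp
  moreover have "card (I - {x}) \<le> matroid_rank indep S"
    using I indep_subset[of I "I - {x}"] by (intro matroid_rank_ge) auto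
  ultimately show "matroid_rank indep (insert x S) \<le> matroid_rank indep S + 1"
    using I by simp
qed

end

text \<open>The two sets agree outside {i, j} and meet it in equally many elements. If they disagree
  at \<open>i\<close>, each contains exactly one of the two, and the transposition exchanges
  them.\<close>

lemma image_transpose_cases:
  assumes "\<And>k. k \<noteq> i \<Longrightarrow> k \<noteq> j \<Longrightarrow> k \<in> J' \<longleftrightarrow> k \<in> J"
    and "i \<in> J' \<and> j \<in> J' \<longleftrightarrow> i \<in> J \<and> j \<in> J"
    and "i \<in> J' \<or> j \<in> J' \<longleftrightarrow> i \<in> J \<or> j \<in> J"
  shows "J' = J \<or> J' = transpose i j ` J"
proof (cases "i \<in> J' \<longleftrightarrow> i \<in> J")
  case True
  then have "x \<in> J' \<longleftrightarrow> x \<in> J" for x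
    using assms by metis
  then show ?thesis by blast
next
  case False
  then have "x \<in> J' \<longleftrightarrow> transpose i j x \<in> J" for x
    using assms by (cases "x = i"; cases "x = j") auto
  also have "transpose i j x \<in> J \<longleftrightarrow> x \<in> transpose i j ` J" for x
    by (metis image_iff transpose_involutory)
  finally show ?thesis by blast
qed

text \<open>Only the \<open>i\<close>-th set of the flag changes, so the rank jumps can differ only
  at positions \<open>i\<close> and \<open>i + 1\<close>. Their total is the same for both
  permutations and each is 0 or 1, so the two jumps are either unchanged or exchanged.\<close>

lemma greedy_basis_adjacent:
  assumes "matroid {1..n} indep" "\<sigma> permutes {1..n}" "i \<in> {1..<n}"
  shows "greedy_basis n indep (\<sigma> \<circ> transpose i (i + 1)) = greedy_basis n indep \<sigma> \<or>
    greedy_basis n indep (\<sigma> \<circ> transpose i (i + 1)) =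
      transpose (\<sigma> i) (\<sigma> (i + 1)) ` greedy_basis n indep \<sigma>"
proof -
  interpret matroid "{1..n}" indep by fact
  let ?t = "transpose i (i + 1)"
  define r where "r k = matroid_rank indep (\<sigma> ` {1..k})" for k
  define r' where "r' k = matroid_rank indep ((\<sigma> \<circ> ?t) ` {1..k})" for k
  define J where "J = {k \<in> {1..n}. r k > r (k - 1)}"
  define J' where "J' = {k \<in> {1..n}. r' k > r' (k - 1)}"
  have step: "r k \<le> r (Suc k)" "r (Suc k) \<le> r k + 1" for k
    using matroid_rank_insert[where S = "\<sigma> ` {1..k}" and x = "\<sigma> (Suc k)"] by (simp_all add: r_def atLeastAtMostSuc_conv)
  have step': "r' k \<le> r' (Suc k)" "r' (Suc k) \<le> r' k + 1" for k
    using matroid_rank_insert[where S = "(\<sigma> \<circ> ?t) ` {1..k}" and x = "(\<sigma> \<circ> ?t) (Suc k)"]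
    by (simp_all add: r'_def atLeastAtMostSuc_conv)
  have eq: "r' k = r k" if "k \<noteq> i" for k
  proof -
    \<comment> \<open>A segment ending before \<open>i\<close> is fixed pointwise; one ending after
      \<open>i\<close> contains both swapped positions.\<close>
    have "?t ` {1..k} = {1..k}"
    proof (cases "k < i")
      case True
      then have "?t x = x" if "x \<in> {1..k}" for x using that by (auto simp: transpose_def)
      then show ?thesis by simp
    next
      case False
      then show ?thesis using that assms(3) by (intro permutes_image permutes_swap_id) auto
    qed
    then show ?thesis by (simp only: r_def r'_def image_comp[symmetric])
  qed
  obtain i' where i': "i = Suc i'" using assms(3) by (cases i) auto
  have "J' = J \<or> J' = ?t ` J"
  proof (rule image_transpose_cases)
    fix k assume "k \<noteq> i" "k \<noteq> i + 1"
    \<comment> \<open>The case \<open>k = 0\<close> is split off because subtraction is truncated;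
      position 0 lies in neither set.\<close>
    then have "k - 1 \<noteq> i \<or> k = 0" by auto
    then show "k \<in> J' \<longleftrightarrow> k \<in> J" using \<open>k \<noteq> i\<close> by (auto simp: J_def J'_def eq)
  next
    \<comment> \<open>Both jumps occur exactly if the rank grows by 2 from \<open>i - 1\<close> to
      \<open>i + 1\<close>, and at least one occurs exactly if it grows at all. By \<open>eq\<close>
      the ranks at these two ends agree.\<close>
    show "i \<in> J' \<and> i + 1 \<in> J' \<longleftrightarrow> i \<in> J \<and> i + 1 \<in> J"
      "i \<in> J' \<or> i + 1 \<in> J' \<longleftrightarrow> i \<in> J \<or> i + 1 \<in> J"
      using step[of i] step[of i'] step'[of i] step'[of i'] eq[of i'] eq[of "Suc i"] assms(3)
      unfolding J_def J'_def i' by auto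
  qed
  moreover have "greedy_basis n indep \<sigma> = \<sigma> ` J"
    by (auto simp: greedy_basis_def J_def r_def)
  \<comment> \<open>Positions and values cross over: unchanged jump positions give bases exchanged
    by the transposition of values, while jump positions exchanged by \<open>?t\<close> give equal
    bases.\<close>
  moreover have "greedy_basis n indep (\<sigma> \<circ> ?t) = \<sigma> ` ?t ` J'"
    by (auto simp: greedy_basis_def J'_def r'_def)
  moreover have "\<sigma> ` ?t ` J = transpose (\<sigma> i) (\<sigma> (i + 1)) ` \<sigma> ` J"
  proof -
    have "\<sigma> (?t x) = transpose (\<sigma> i) (\<sigma> (i + 1)) (\<sigma> x)" for x
      using permutes_inj[OF assms(2)] by (auto simp: transpose_def dest: injD)
    then show ?thesis by (simp add: image_image)
  qed
  ultimately show ?thesis by (auto simp: image_image)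
qed

section \<open>The summands of the matroid invariant\<close>

text \<open>The \<open>i\<close>-th factor of \<open>Q_cone\<close>, with numerator and denominator
  multiplied by \<open>ratfun_var (\<sigma> i)\<close> so that the denominator is a difference of
  two variables.\<close>

definition cone_factor :: "(nat \<Rightarrow> nat) \<Rightarrow> nat \<Rightarrow> laurent fract" where
  "cone_factor \<sigma> i = ratfun_var (\<sigma> i) / (ratfun_var (\<sigma> i) - ratfun_var (\<sigma> (i + 1)))"

lemma Q_cone_eq_prod: "Q_cone n \<sigma> = (\<Prod>i\<in>{1..<n}. cone_factor \<sigma> i)"
proof -
  have "cone_factor \<sigma> i = 1 / (1 - ratfun_var (\<sigma> (i + 1)) / ratfun_var (\<sigma> i))" for i
    by (simp add: cone_factor_def diff_divide_distrib[symmetric] divide_simps)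
  then show ?thesis by (simp add: Q_cone_def prod_dividef)
qed

definition Q_term ::
  "nat \<Rightarrow> (nat set \<Rightarrow> bool) \<Rightarrow> ((nat \<Rightarrow> nat) \<Rightarrow> laurent) \<Rightarrow> (nat \<Rightarrow> nat) \<Rightarrow> laurent fract" where
  "Q_term n indep f \<sigma> = to_fract (f \<sigma>) * Q_cone n \<sigma> *
     (\<Prod>i \<in> {1..n} - greedy_basis n indep \<sigma>. 1 - ratfun_var i)"

lemma cone_factor_regular:
  assumes "\<sigma> permutes {1..n}" "{\<sigma> i, \<sigma> (i + 1)} \<noteq> {a, b}"
  shows "cone_factor \<sigma> i \<in> regular_at a b"
proof -
  have "\<sigma> i \<noteq> \<sigma> (i + 1)" using permutes_inj[OF assms(1)] by (auto dest: injD)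
  then have "ratfun_var (\<sigma> i) * (1 / (ratfun_var (\<sigma> i) - ratfun_var (\<sigma> (i + 1)))) \<in> regular_at a b"
    using assms(2) by (intro regular_at_mult regular_at_inverse_var_diff) auto
  then show ?thesis by (simp add: cone_factor_def)
qed

lemma Q_term_regular:
  assumes "\<sigma> permutes {1..n}" "\<And>i. i \<in> {1..<n} \<Longrightarrow> {\<sigma> i, \<sigma> (i + 1)} \<noteq> {a, b}"
  shows "Q_term n indep f \<sigma> \<in> regular_at a b"
  unfolding Q_term_def Q_cone_eq_prod using assms
  by (intro regular_at_mult regular_at_prod cone_factor_regular[OF assms(1)] regular_at_diff) auto

text \<open>Once the \<open>i\<close>-th cone factor is split off, the two summands are u / (x_a -
  x_b) and -v / (x_a - x_b), where u and v are products of pairwise congruent factors.\<close>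

lemma Q_term_adjacent_regular:
  assumes "matroid {1..n} indep" "f \<in> PLaur n" "\<sigma> permutes {1..n}"
    and i: "i \<in> {1..<n}" and ab: "\<sigma> i = a" "\<sigma> (i + 1) = b"
  shows "Q_term n indep f \<sigma> + Q_term n indep f (transpose a b \<circ> \<sigma>) \<in> regular_at a b"
proof -
  define \<sigma>' where "\<sigma>' = transpose a b \<circ> \<sigma>"
  have inj: "\<sigma> k = \<sigma> l \<longleftrightarrow> k = l" for k l
    using permutes_inj[OF assms(3)] by (auto dest: injD)
  \<comment> \<open>Exchanging the values \<open>a\<close> and \<open>b\<close> amounts to
    exchanging the positions \<open>i\<close> and \<open>i + 1\<close>, the form that
    \<open>PLaur\<close> and \<open>greedy_basis_adjacent\<close> speak about.\<close>
  have \<sigma>'_alt: "\<sigma>' = \<sigma> \<circ> transpose i (i + 1)"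
    by (auto simp: \<sigma>'_def fun_eq_iff transpose_def inj simp flip: ab)
  have "a \<in> {1..n}" "b \<in> {1..n}"
    using i permutes_in_image[OF assms(3), of i] permutes_in_image[OF assms(3), of "i + 1"]
    by (auto simp flip: ab)
  then have perm': "\<sigma>' permutes {1..n}"
    unfolding \<sigma>'_def by (intro permutes_compose[OF assms(3)] permutes_swap_id)
  have "a \<noteq> b" using inj[of i "i + 1"] ab by simp
  have ab': "\<sigma>' i = b" "\<sigma>' (i + 1) = a"
    using ab by (simp_all add: \<sigma>'_def)
  let ?R = "\<lambda>\<sigma>. \<Prod>j\<in>{1..<n} - {i}. cone_factor \<sigma> j"
  let ?M = "\<lambda>\<sigma>. \<Prod>j \<in> {1..n} - greedy_basis n indep \<sigma>. 1 - ratfun_var j"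
  have Q_term_eq: "Q_term n indep f \<rho> = to_fract (f \<rho>) * (cone_factor \<rho> i * ?R \<rho>) * ?M \<rho>" for \<rho>
    unfolding Q_term_def Q_cone_eq_prod using prod.remove[OF _ i, of "cone_factor \<rho>"] by simp
  have "cong_at a b (to_fract (f \<sigma>)) (to_fract (f \<sigma>'))"
  proof -
    obtain g where "f \<sigma> - f \<sigma>' = (laurent_var a - laurent_var b) * g"
      using assms(2,3) i ab unfolding PLaur_def \<sigma>'_alt by blast
    then have "to_fract (f \<sigma>) - to_fract (f \<sigma>') = (ratfun_var a - ratfun_var b) * to_fract g"
      unfolding ratfun_var_def by (simp flip: to_fract_diff to_fract_mult)
    then show ?thesis by (auto simp: cong_at_def)
  qed
  moreover have "cong_at a b (ratfun_var a) (ratfun_var b)"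
    using cong_at_var_transpose[of a b a] by simp
  moreover have "cong_at a b (?R \<sigma>) (?R \<sigma>')"
  proof (rule cong_at_prod)
    fix j assume j: "j \<in> {1..<n} - {i}"
    have var: "cong_at a b (ratfun_var (\<sigma> k)) (ratfun_var (\<sigma>' k))" for k
      unfolding \<sigma>'_def using cong_at_var_transpose by simp
    have ne: "\<sigma> j \<noteq> \<sigma> (j + 1)" "\<sigma>' j \<noteq> \<sigma>' (j + 1)"
      using inj_eq[OF permutes_inj[OF assms(3)]] inj_eq[OF permutes_inj[OF perm']] by simp_all
    \<comment> \<open>By injectivity, neighbours with values \<open>a\<close> and \<open>b\<close>
      can only sit at position \<open>i\<close>.\<close>
    have "{\<sigma> j, \<sigma> (j + 1)} \<noteq> {a, b}"
      using j inj unfolding ab[symmetric] by (auto simp: doubleton_eq_iff)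
    moreover from this have "{\<sigma>' j, \<sigma>' (j + 1)} \<noteq> {a, b}"
      unfolding \<sigma>'_def by (auto simp: doubleton_eq_iff transpose_def split: if_splits)
    ultimately have "cong_at a b (1 / (ratfun_var (\<sigma> j) - ratfun_var (\<sigma> (j + 1))))
        (1 / (ratfun_var (\<sigma>' j) - ratfun_var (\<sigma>' (j + 1))))"
      using ne by (intro cong_at_inverse cong_at_diff var regular_at_inverse_var_diff) auto
    from cong_at_mult[OF var[of j] this] show "cong_at a b (cone_factor \<sigma> j) (cone_factor \<sigma>' j)"
      by (simp add: cone_factor_def)
  qed
  moreover have "cong_at a b (?M \<sigma>) (?M \<sigma>')"
  proof -
    let ?t = "transpose a b"
    have regular: "?M \<rho> \<in> regular_at a b" for \<rho>
      by (intro regular_at_prod regular_at_diff) auto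
    have "greedy_basis n indep \<sigma>' = greedy_basis n indep \<sigma> \<or>
      greedy_basis n indep \<sigma>' = ?t ` greedy_basis n indep \<sigma>"
      using greedy_basis_adjacent[OF assms(1,3) i] unfolding \<sigma>'_alt ab by simp
    then show ?thesis
    proof
      assume "greedy_basis n indep \<sigma>' = greedy_basis n indep \<sigma>"
      then show ?thesis using cong_at_refl[OF regular] by simp
    next
      assume B: "greedy_basis n indep \<sigma>' = ?t ` greedy_basis n indep \<sigma>"
      have "?t ` {1..n} = {1..n}"
        using \<open>a \<in> {1..n}\<close> \<open>b \<in> {1..n}\<close> by (intro permutes_image permutes_swap_id)
      \<comment> \<open>Complements commute with the bijection \<open>?t\<close>, so the product can
        be reindexed over the old complement, where each factor is replaced by a congruent
        one.\<close>
      then have "{1..n} - greedy_basis n indep \<sigma>' = ?t ` ({1..n} - greedy_basis n indep \<sigma>)"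
        by (simp add: B image_set_diff)
      then have "?M \<sigma>' = (\<Prod>j \<in> {1..n} - greedy_basis n indep \<sigma>. 1 - ratfun_var (?t j))"
        by (simp add: prod.reindex o_def)
      then show ?thesis
        by (auto intro!: cong_at_prod cong_at_diff cong_at_refl cong_at_var_transpose)
    qed
  qed
  ultimately have "cong_at a b (to_fract (f \<sigma>) * ratfun_var a * ?R \<sigma> * ?M \<sigma>)
      (to_fract (f \<sigma>') * ratfun_var b * ?R \<sigma>' * ?M \<sigma>')" (is "cong_at a b ?u ?v")
    by (intro cong_at_mult)
  then have "(?u - ?v) / (ratfun_var a - ratfun_var b) \<in> regular_at a b"
    using \<open>a \<noteq> b\<close> by (rule cong_at_diff_quotient_regular)
  also have "(?u - ?v) / (ratfun_var a - ratfun_var b) = Q_term n indep f \<sigma> + Q_term n indep f \<sigma>'"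
  proof -
    \<comment> \<open>The reversed order of \<open>a\<close> and \<open>b\<close> supplies the sign
      that turns the difference of numerators into a sum of summands.\<close>
    have "cone_factor \<sigma>' i = - (ratfun_var b / (ratfun_var a - ratfun_var b))"
      unfolding cone_factor_def ab' by (metis minus_diff_eq minus_divide_right)
    moreover have "cone_factor \<sigma> i = ratfun_var a / (ratfun_var a - ratfun_var b)"
      unfolding cone_factor_def ab ..
    ultimately show ?thesis
      unfolding Q_term_eq by (simp add: diff_divide_distrib mult.assoc)
  qed
  finally show ?thesis unfolding \<sigma>'_def .
qed

lemma Q_matroid_regular:
  assumes "matroid {1..n} indep" "f \<in> PLaur n" "a \<in> {1..n}" "b \<in> {1..n}"
  shows "Q_matroid n indep f \<in> regular_at a b"
proof (rule regular_at_half)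
  \<comment> \<open>Doubling pairs \<open>\<sigma>\<close> with \<open>(a b) \<circ> \<sigma>\<close> without choosing orbit representatives.\<close>
  let ?t = "transpose a b"
  have perm_t: "?t permutes {1..n}" using assms(3,4) by (rule permutes_swap_id)
  have Q: "Q_matroid n indep f = (\<Sum>\<sigma> | \<sigma> permutes {1..n}. Q_term n indep f \<sigma>)"
    by (simp add: Q_matroid_def Q_term_def)
  also have "\<dots> = (\<Sum>\<sigma> | \<sigma> permutes {1..n}. Q_term n indep f (?t \<circ> \<sigma>))"
    by (rule setum_permutations_compose_left[OF perm_t])
  finally have Q': "Q_matroid n indep f = (\<Sum>\<sigma> | \<sigma> permutes {1..n}. Q_term n indep f (?t \<circ> \<sigma>))" .
  have "Q_matroid n indep f + Q_matroid n indep f =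
      (\<Sum>\<sigma> | \<sigma> permutes {1..n}. Q_term n indep f \<sigma> + Q_term n indep f (?t \<circ> \<sigma>))"
    unfolding sum.distrib by (simp only: Q[symmetric] Q'[symmetric])
  also have "\<dots> \<in> regular_at a b"
  proof (rule regular_at_sum, clarify)
    fix \<sigma> assume \<sigma>: "\<sigma> permutes {1..n}"
    have \<sigma>': "(?t \<circ> \<sigma>) permutes {1..n}" using \<sigma> perm_t by (rule permutes_compose)
    have inv: "?t \<circ> (?t \<circ> \<sigma>) = \<sigma>" by (simp add: fun_eq_iff)
    consider i where "i \<in> {1..<n}" "\<sigma> i = a" "\<sigma> (i + 1) = b"
      | i where "i \<in> {1..<n}" "\<sigma> i = b" "\<sigma> (i + 1) = a"
      | "\<And>i. i \<in> {1..<n} \<Longrightarrow> {\<sigma> i, \<sigma> (i + 1)} \<noteq> {a, b}"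
      by (metis doubleton_eq_iff)
    then show "Q_term n indep f \<sigma> + Q_term n indep f (?t \<circ> \<sigma>) \<in> regular_at a b"
    proof cases
      case 1
      then show ?thesis using Q_term_adjacent_regular[OF assms(1,2) \<sigma>] by blast
    next
      case 2
      \<comment> \<open>Here \<open>?t \<circ> \<sigma>\<close> has \<open>a\<close> before
        \<open>b\<close>, and applying \<open>?t\<close> once more returns to
        \<open>\<sigma>\<close>.\<close>
      then have "Q_term n indep f (?t \<circ> \<sigma>) + Q_term n indep f (?t \<circ> (?t \<circ> \<sigma>)) \<in> regular_at a b"
        using Q_term_adjacent_regular[OF assms(1,2) \<sigma>', of i a b] by simp
      then show ?thesis unfolding inv by (simp add: add.commute)
    next
      case 3
      have "{(?t \<circ> \<sigma>) i, (?t \<circ> \<sigma>) (i + 1)} \<noteq> {a, b}" if "i \<in> {1..<n}" for i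
        using 3[OF that] by (auto simp: doubleton_eq_iff transpose_def split: if_splits)
      then show ?thesis
        using 3 \<sigma> \<sigma>' by (intro regular_at_add Q_term_regular) auto
    qed
  qed
  finally show "Q_matroid n indep f + Q_matroid n indep f \<in> regular_at a b" .
qed

section \<open>Clearing denominators\<close>

abbreviation offdiag :: "nat \<Rightarrow> (nat \<times> nat) set" where
  "offdiag n \<equiv> {(a, b). a \<in> {1..n} \<and> b \<in> {1..n} \<and> a \<noteq> b}"

lemma finite_offdiag: "finite (offdiag n)"
  by (rule finite_subset[of _ "{1..n} \<times> {1..n}"]) auto

lemma prod_var_diff_laurent_fracts:
  assumes "A \<subseteq> offdiag n"
  shows "(\<Prod>(a, b)\<in>A. ratfun_var a - ratfun_var b) \<in> laurent_fracts n"
proof (intro laurent_fracts_prod, clarify)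
  fix a b assume "(a, b) \<in> A"
  then have "a \<in> {1..n}" "b \<in> {1..n}" using assms by auto
  then show "ratfun_var a - ratfun_var b \<in> laurent_fracts n"
    by (intro laurent_fracts_diff laurent_fracts_var)
qed

text \<open>Since the pairs are ordered, the product contains every denominator of every cone with
  the right sign. Different positions use different pairs, so each denominator cancels against its
  own factor and leaves a single variable.\<close>

lemma Q_cone_clear_denominators:
  assumes "\<sigma> permutes {1..n}"
  shows "(\<Prod>(a, b)\<in>offdiag n. ratfun_var a - ratfun_var b) * Q_cone n \<sigma> \<in> laurent_fracts n"
proof -
  let ?d = "\<lambda>(a, b). ratfun_var a - ratfun_var b"
  let ?h = "\<lambda>i. (\<sigma> i, \<sigma> (i + 1))"
  let ?H = "?h ` {1..<n}"
  have inj: "\<sigma> k = \<sigma> l \<longleftrightarrow> k = l" for k l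
    using permutes_inj[OF assms] by (auto dest: injD)
  have mem: "\<sigma> k \<in> {1..n} \<longleftrightarrow> k \<in> {1..n}" for k
    by (rule permutes_in_image[OF assms])
  have sub: "?H \<subseteq> offdiag n"
    using mem inj by fastforce
  have "prod ?d (offdiag n) = prod ?d (offdiag n - ?H) * prod ?d ?H"
    by (rule prod.subset_diff[OF sub finite_offdiag])
  also have "prod ?d ?H = (\<Prod>i\<in>{1..<n}. ratfun_var (\<sigma> i) - ratfun_var (\<sigma> (i + 1)))"
    by (subst prod.reindex) (auto simp: inj_on_def inj)
  finally have "prod ?d (offdiag n) * Q_cone n \<sigma> = prod ?d (offdiag n - ?H) *
      (\<Prod>i\<in>{1..<n}. (ratfun_var (\<sigma> i) - ratfun_var (\<sigma> (i + 1))) * cone_factor \<sigma> i)"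
    by (simp add: Q_cone_eq_prod prod.distrib mult.assoc)
  also have "(\<Prod>i\<in>{1..<n}. (ratfun_var (\<sigma> i) - ratfun_var (\<sigma> (i + 1))) * cone_factor \<sigma> i) =
      (\<Prod>i\<in>{1..<n}. ratfun_var (\<sigma> i))"
    by (intro prod.cong) (auto simp: cone_factor_def inj)
  also have "prod ?d (offdiag n - ?H) * (\<Prod>i\<in>{1..<n}. ratfun_var (\<sigma> i)) \<in> laurent_fracts n"
  proof (intro laurent_fracts_mult prod_var_diff_laurent_fracts laurent_fracts_prod laurent_fracts_var)
    show "\<sigma> i \<in> {1..n}" if "i \<in> {1..<n}" for i
      using that by (subst mem) simp
  qed blast
  finally show ?thesis .
qed

lemma Q_matroid_clear_denominators:
  assumes "f \<in> PLaur n"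
  shows "(\<Prod>(a, b)\<in>offdiag n. ratfun_var a - ratfun_var b) * Q_matroid n indep f \<in> laurent_fracts n"
proof -
  let ?D = "\<Prod>(a, b)\<in>offdiag n. ratfun_var a - ratfun_var b"
  have "?D * Q_matroid n indep f = (\<Sum>\<sigma> | \<sigma> permutes {1..n}. to_fract (f \<sigma>) * (?D * Q_cone n \<sigma>) *
        (\<Prod>i \<in> {1..n} - greedy_basis n indep \<sigma>. 1 - ratfun_var i))"
    by (simp only: Q_matroid_def sum_distrib_left mult_ac)
  also have "\<dots> \<in> laurent_fracts n"
  proof (rule laurent_fracts_sum)
    fix \<sigma> assume "\<sigma> \<in> {\<sigma>. \<sigma> permutes {1..n}}"
    then have \<sigma>: "\<sigma> permutes {1..n}" by simp
    have "to_fract (f \<sigma>) \<in> laurent_fracts n"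
      using assms \<sigma> by (simp add: PLaur_def)
    moreover have "(\<Prod>i \<in> {1..n} - greedy_basis n indep \<sigma>. 1 - ratfun_var i) \<in> laurent_fracts n"
      by (intro laurent_fracts_prod laurent_fracts_diff laurent_fracts_1 laurent_fracts_var) auto
    ultimately show "to_fract (f \<sigma>) * (?D * Q_cone n \<sigma>) *
        (\<Prod>i \<in> {1..n} - greedy_basis n indep \<sigma>. 1 - ratfun_var i) \<in> laurent_fracts n"
      using Q_cone_clear_denominators[OF \<sigma>] laurent_fracts_mult by blast
  qed
  finally show ?thesis .
qed

theorem theorem1p1:
  fixes n :: nat
    and indep :: "nat set \<Rightarrow> bool"
    and f :: "(nat \<Rightarrow> nat) \<Rightarrow> laurent"
  assumes "n \<ge> 1"
    and "matroid {1..n} indep"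
    and "f \<in> PLaur n"
  shows "Q_matroid n indep f \<in> to_fract ` laurent_ring n"
proof -
  let ?D = "\<Prod>(a, b)\<in>offdiag n. ratfun_var a - ratfun_var b"
  obtain p where p: "p \<in> laurent_ring n" "?D * Q_matroid n indep f = to_fract p"
    using Q_matroid_clear_denominators[OF assms(3), of indep] by auto
  have "?D \<in> laurent_fracts n"
    by (intro prod_var_diff_laurent_fracts subset_refl)
  then obtain d where d: "d \<in> laurent_ring n" "?D = to_fract d"
    by auto
  have "?D \<noteq> 0" using finite_offdiag by auto
  then have "d \<noteq> 0" using d by auto
  \<comment> \<open>At first all variables are allowed in the resulting Laurent polynomial; the
    bound on the indices is recovered afterwards.\<close>
  have "Q_matroid n indep f \<in> range to_fract"
  proof (rule laurent_if_regular[OF finite_offdiag])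
    show "a \<noteq> b \<and> Q_matroid n indep f \<in> regular_at a b" if "(a, b) \<in> offdiag n" for a b
      using that Q_matroid_regular[OF assms(2,3)] by blast
    show "?D * Q_matroid n indep f \<in> range to_fract"
      unfolding p(2) by (rule rangeI)
  qed
  then obtain q where q: "Q_matroid n indep f = to_fract q" by auto
  with p d have "d * q = p" by (metis to_fract_eq_iff to_fract_mult)
  \<comment> \<open>The endomorphism \<open>truncate_vars n\<close> fixes \<open>d\<close> and
    \<open>p\<close>; cancelling the nonzero \<open>d\<close> then shows that it fixes
    \<open>q\<close> as well.\<close>
  then have "truncate_vars n (d * q) = d * q"
    using p(1) by (simp only: laurent_ring_iff)
  then have "d * truncate_vars n q = d * q"
    using d(1) by (simp only: monomial_subst_mult laurent_ring_iff)
  then have "q \<in> laurent_ring n"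
    using \<open>d \<noteq> 0\<close> by (simp add: laurent_ring_iff)
  then show ?thesis using q by simp
qed

end
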